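(* Let $1\le\ell_1\le k_1$ and $1\le \ell_2\le k_2$ be integers, let $0<p\le 1$, $q=1-p$, and put $a(p)=q^{\ell_1}p^{\ell_2}$, $\ell=\ell_1+\ell_2$, $m_1=k_1-\ell_1+1$, $m_2=k_2-\ell_2+1$. Let $H^n_{\ell_1,k_1,\ell_2,k_2}$ be the number of occurrences, in $n$ independent Bernoulli($p$) trials, of at least $\ell_1$ and at most $k_1$ consecutive 0's followed by at least $\ell_2$ and at most $k_2$ consecutive 1's, and let $\phi_n(t)$, $p_{m,n}$, $\mu_{n,j}$ be its probability generating function, probability mass function and $j$-th non-central moment. Write $\mathbf 1(\cdot)$ for the indicator. Then, for all $n\ge \ell+1$: (i) $$\begin{aligned}\phi_n(t)&=\phi_{n-1}(t)+a(p)(t-1)\left[\phi_{n-\ell}(t)-q^{m_1}\phi_{n-\ell-m_1}(t)-p^{m_2}\phi_{n-\ell-m_2}(t)+q^{m_1}p^{m_2}\phi_{n-\ell-m_1-m_2}(t)\right]\\&\quad-a(p)(t-1)p^{n-\ell}\left(\mathbf 1(\ell+1\le n\le \ell+m_2-1)-\left(\tfrac{q}{p}\right)^{m_1}\mathbf 1(\ell+m_1\le n\le \ell+m_1+m_2-1)\right),\end{aligned}$$ with initial conditions $\phi_n(t)=1$ for $0\le n\le \ell$ (and $\phi_n(t)=0$ for $n<0$). (ii) For every integer $m\ge0$, $$\begin{aligned}p_{m,n}&=p_{m,n-1}-a(p)\,p^{n-\ell}\Big[\mathbf 1(m=1,\ \ell+1\le n\le \ell+m_2-1)-\mathbf 1(m=0,\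 \ell+1\le n\le \ell+m_2-1)\\&\quad-\left(\tfrac{q}{p}\right)^{m_1}\Big(\mathbf 1(m=1,\ \ell+m_1\le n\le \ell+m_1+m_2-1)-\mathbf 1(m=0,\ \ell+m_1\le n\le \ell+m_1+m_2-1)\Big)\Big]\\&\quad+a(p)\Big[p_{m-1,n-\ell}-p_{m,n-\ell}-q^{m_1}(p_{m-1,n-\ell-m_1}-p_{m,n-\ell-m_1})-p^{m_2}(p_{m-1,n-\ell-m_2}-p_{m,n-\ell-m_2})\\&\quad+q^{m_1}p^{m_2}(p_{m-1,n-\ell-m_1-m_2}-p_{m,n-\ell-m_1-m_2})\Big],\end{aligned}$$ with initial conditions $p_{0,n}=1$ and $p_{m,n}=0$ for $m>0$, when $0\le n\le \ell$ (and $p_{m,n}=0$ if $n<0$ or $m<0$). (iii) For every integer $j\ge1$, $$\begin{aligned}\mu_{n,j}&=\mu_{n-1,j}+a(p)\sum_{k=0}^{j-1}\binom{j}{k}\left[\mu_{n-\ell,k}-q^{m_1}\mu_{n-\ell-m_1,k}-p^{m_2}\mu_{n-\ell-m_2,k}+q^{m_1}p^{m_2}\mu_{n-\ell-m_1-m_2,k}\right]\\&\quad-a(p)\,p^{n-\ell}\left[\mathbf 1(\ell+1\le n\le \ell+m_2-1)-\left(\tfrac{q}{p}\right)^{m_1}\mathbf 1(\ell+m_1\le n\le \ell+m_1+m_2-1)\right],\end{aligned}$$ with initial conditions $\mu_{n,0}=1$ for $n\ge0$, $\mu_{n,j}=0$ for all $j\ge1$ and $0\le n\le \ell$ (and $\mu_{n,j}=0$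 for all $j\ge0$ if $n<0$).
   Context: Let $\zeta_1,\zeta_2,\dots$ be independent with $P(\zeta_i=1)=p$ and $P(\zeta_i=0)=q=1-p$. $H^n_{\ell_1,k_1,\ell_2,k_2}$ is the number of occurrences of the following pattern within $\zeta_1,\dots,\zeta_n$: a maximal block of consecutive 0's (i.e. one starting at position 1 or immediately preceded by a 1, and ended by a 1) of length $j$ with $\ell_1\le j\le k_1$, immediately followed by exactly $i$ consecutive 1's for some $\ell_2\le i\le k_2$, immediately followed by a 0, where this terminating 0 is at a position $\le n$. (The pattern is counted only when the terminating 0 occurs, so a final block of 1's not yet ended by a 0 within the first $n$ trials is not counted; the terminating 0 may be the first 0 of the next pattern.) For example, for the sequence 00111101100010100011 of length 20, $H^{20}_{1,1,1,1}=1$, $H^{20}_{1,2,2,2}=1$, $H^{20}_{1,1,1,2}=2$, $H^{20}_{1,2,1,2}=2$. For $n\ge0$: $\phi_n(t)=E\big[t^{H^n_{\ell_1,k_1,\ell_2,k_2}}\big]$, $p_{m,n}=P(H^n_{\ell_1,k_1,\ell_2,k_2}=m)$, $\mu_{n,j}=E\big[(H^n_{\ell_1,k_1,\ell_2,k_2})^j\big]$ (with $0^0=1$, so $\mu_{n,0}=1$). Quantities with a negative time index $n$ are set equal to $0$. *)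

theory Defs
  imports "HOL-Probability.Probability"
begin

text \<open>
  Trial sequences are functions \<open>x\<close> on \<^typ>\<open>nat\<close> of which only the values at positions
  \<open>1, 2, \<dots>\<close> matter.  A triple \<open>(s, j, i)\<close> is an occurrence within the first \<open>n\<close> trials if a maximal
  block of \<open>j\<close> zeros starts at position \<open>s\<close>, is followed by exactly \<open>i\<close> ones, and the zero ending
  this block of ones, at position \<open>s + j + i\<close>, is among the first \<open>n\<close> trials.
\<close>

definition occurrences ::
  "nat \<Rightarrow> nat \<Rightarrow> nat \<Rightarrow> nat \<Rightarrow> nat \<Rightarrow> (nat \<Rightarrow> nat) \<Rightarrow> (nat \<times> nat \<times> nat) set" where
  "occurrences l1 k1 l2 k2 n x =
    {(s, j, i). 1 \<le> s \<and> l1 \<le> j \<and> j \<le> k1 \<and> l2 \<le> i \<and> i \<le> k2 \<and> s + j + i \<le> n \<and>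
       (s = 1 \<or> x (s - 1) = 1) \<and>
       (\<forall>r\<in>{s..<s + j}. x r = 0) \<and>
       (\<forall>r\<in>{s + j..<s + j + i}. x r = 1) \<and>
       x (s + j + i) = 0}"

definition H :: "nat \<Rightarrow> nat \<Rightarrow> nat \<Rightarrow> nat \<Rightarrow> nat \<Rightarrow> (nat \<Rightarrow> nat) \<Rightarrow> nat" where
  "H l1 k1 l2 k2 n x = card (occurrences l1 k1 l2 k2 n x)"

definition bernoulli_trials :: "'a measure \<Rightarrow> (nat \<Rightarrow> 'a \<Rightarrow> nat) \<Rightarrow> real \<Rightarrow> bool" where
  "bernoulli_trials M \<zeta> p \<longleftrightarrow>
     prob_space M \<and>
     prob_space.indep_vars M (\<lambda>_. count_space UNIV) \<zeta> {1..} \<and>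
     (\<forall>i\<ge>1. measure M {\<omega> \<in> space M. \<zeta> i \<omega> = 1} = p \<and>
            measure M {\<omega> \<in> space M. \<zeta> i \<omega> = 0} = 1 - p)"

text \<open>
  The time index (and the index \<open>m\<close> of the mass function) is an integer, since the recurrences
  refer to negative indices, where all three quantities are \<open>0\<close> by convention.
\<close>

definition H_pgf ::
  "'a measure \<Rightarrow> (nat \<Rightarrow> 'a \<Rightarrow> nat) \<Rightarrow> nat \<Rightarrow> nat \<Rightarrow> nat \<Rightarrow> nat \<Rightarrow> int \<Rightarrow> real \<Rightarrow> real" where
  "H_pgf M \<zeta> l1 k1 l2 k2 n t =
    (if n < 0 then 0
     else prob_space.expectation M (\<lambda>\<omega>. t ^ H l1 k1 l2 k2 (nat n) (\<lambda>i. \<zeta> i \<omega>)))"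

definition H_pmf ::
  "'a measure \<Rightarrow> (nat \<Rightarrow> 'a \<Rightarrow> nat) \<Rightarrow> nat \<Rightarrow> nat \<Rightarrow> nat \<Rightarrow> nat \<Rightarrow> int \<Rightarrow> int \<Rightarrow> real" where
  "H_pmf M \<zeta> l1 k1 l2 k2 m n =
    (if n < 0 then 0
     else prob_space.prob M {\<omega> \<in> space M. int (H l1 k1 l2 k2 (nat n) (\<lambda>i. \<zeta> i \<omega>)) = m})"

definition H_moment ::
  "'a measure \<Rightarrow> (nat \<Rightarrow> 'a \<Rightarrow> nat) \<Rightarrow> nat \<Rightarrow> nat \<Rightarrow> nat \<Rightarrow> nat \<Rightarrow> int \<Rightarrow> nat \<Rightarrow> real" where
  "H_moment M \<zeta> l1 k1 l2 k2 n j =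
    (if n < 0 then 0
     else prob_space.expectation M (\<lambda>\<omega>. real (H l1 k1 l2 k2 (nat n) (\<lambda>i. \<zeta> i \<omega>)) ^ j))"

end

theory Submission
  imports Defs
begin

text \<open>
  Write \<open>D m = h (m + 1) - h m\<close>.  Conditioning on the lengths \<open>j\<close> and \<open>i\<close> of the runs of the
  occurrence that is completed at time \<open>n\<close> (at most one is) gives
  \<open>E h(H\<^sup>n) - E h(H\<^sup>n\<^sup>-\<^sup>1) = (\<Sum>j i. q\<^sup>j p\<^sup>i g (n - i - j))\<close>, where \<open>g s\<close> is the expectation of \<open>D(H\<^sup>s)\<close>
  on the event that a block of zeros starts at \<open>s\<close>.  If \<open>f s\<close> is the expectation of \<open>D(H\<^sup>s)\<close>
  on the event that trial \<open>s\<close> is a zero, then \<open>g s = f s - q f (s - 1)\<close>, because a second zero in a row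
  completes nothing, and \<open>f s = E D(H\<^sup>s) - p E D(H\<^sup>s\<^sup>-\<^sup>1)\<close> for \<open>s \<ge> 1\<close>, because a one completes nothing.
  Hence both sums telescope.  At \<open>s = 0\<close> the second identity fails by \<open>D 0\<close>; this defect is the
  source of the indicator terms.  The three recurrences are the cases \<open>h m = t\<^sup>m\<close>,
  \<open>h k = 1(k = m)\<close> and \<open>h m = m\<^sup>j\<close>.
\<close>

section \<open>Occurrences\<close>

lemma occurrences_subset: "occurrences l1 k1 l2 k2 n x \<subseteq> {1..n} \<times> {..n} \<times> {..n}"
  by (auto simp: occurrences_def)

lemma finite_occurrences [simp]: "finite (occurrences l1 k1 l2 k2 n x)"
  by (rule finite_subset[OF occurrences_subset]) auto

text \<open>This bound makes the count finitely valued, so that every function of it, whatever its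
  growth, is bounded and hence integrable.\<close>

lemma H_le: "H l1 k1 l2 k2 n x \<le> card ({1..n} \<times> {..n} \<times> {..n})"
  unfolding H_def by (intro card_mono occurrences_subset) auto

lemma H_cong:
  assumes "\<And>r. 1 \<le> r \<Longrightarrow> r \<le> n \<Longrightarrow> x r = y r"
  shows "H l1 k1 l2 k2 n x = H l1 k1 l2 k2 n y"
proof -
  have "occurrences l1 k1 l2 k2 n x \<subseteq> occurrences l1 k1 l2 k2 n y"
    if xy: "\<And>r. 1 \<le> r \<Longrightarrow> r \<le> n \<Longrightarrow> x r = y r" for x y
  proof (rule subsetI, clarify)
    fix s j i assume o: "(s, j, i) \<in> occurrences l1 k1 l2 k2 n x"
    then have b: "1 \<le> s" "s + j + i \<le> n" by (auto simp: occurrences_def)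
    \<comment> \<open>Position 0 is not a trial, so the two sequences may differ there; for
      \<open>s = 1\<close> the first alternative holds instead.\<close>
    have "s = 1 \<or> x (s - 1) = y (s - 1)" using b by (cases "s = 1") (auto intro!: xy)
    moreover have "\<forall>r\<in>{s..<s + j}. x r = y r" using b xy by auto
    moreover have "\<forall>r\<in>{s + j..<s + j + i}. x r = y r" using b xy by auto
    moreover have "x (s + j + i) = y (s + j + i)" using b xy by auto
    ultimately show "(s, j, i) \<in> occurrences l1 k1 l2 k2 n y"
      using o by (auto simp: occurrences_def)
  qed
  from this[of x y] this[of y x] assms show ?thesis
    unfolding H_def by (metis subset_antisym)
qed

text \<open>An occurrence takes up at least \<open>l1 + l2 + 1\<close> positions, its final zero
  included. The initial conditions at times up to \<open>l1 + l2\<close> rest on this.\<close>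

lemma H_eq_0:
  assumes "n \<le> l1 + l2"
  shows "H l1 k1 l2 k2 n x = 0"
proof -
  have "occurrences l1 k1 l2 k2 n x = {}" using assms by (auto simp: occurrences_def)
  then show ?thesis by (simp add: H_def)
qed

text \<open>An occurrence can only end at a zero that is preceded by a one.\<close>

lemma H_eq_if_no_end:
  assumes "1 \<le> l2" "s \<le> n"
    and "\<And>e. s < e \<Longrightarrow> e \<le> n \<Longrightarrow> x e = 0 \<Longrightarrow> x (e - 1) \<noteq> 1"
  shows "H l1 k1 l2 k2 n x = H l1 k1 l2 k2 s x"
proof -
  have "u + j + i \<le> s" if o: "(u, j, i) \<in> occurrences l1 k1 l2 k2 n x" for u j i
  proof (rule ccontr)
    assume "\<not> u + j + i \<le> s"
    moreover have "x (u + j + i - 1) = 1"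
    proof -
      have "u + j + i - 1 \<in> {u + j..<u + j + i}"
        using o assms(1) by (auto simp: occurrences_def)
      then show ?thesis using o unfolding occurrences_def by blast
    qed
    ultimately show False
      using o assms(3)[of "u + j + i"] by (auto simp: occurrences_def)
  qed
  then have "occurrences l1 k1 l2 k2 n x = occurrences l1 k1 l2 k2 s x"
    using assms(2) by (fastforce simp: occurrences_def)
  then show ?thesis by (simp add: H_def)
qed

section \<open>Patterns with a prescribed final position\<close>

definition pattern_at :: "nat \<Rightarrow> nat \<Rightarrow> nat \<Rightarrow> (nat \<Rightarrow> nat) \<Rightarrow> bool" where
  "pattern_at s j i x \<longleftrightarrow>
     (s = 1 \<or> x (s - 1) = 1) \<and>
     (\<forall>r\<in>{s..<s + j}. x r = 0) \<and>
     (\<forall>r\<in>{s + j..<s + j + i}. x r = 1) \<and>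
     x (s + j + i) = 0"

lemma pattern_at_zeroD: "pattern_at s j i x \<Longrightarrow> s \<le> r \<Longrightarrow> r < s + j \<Longrightarrow> x r = 0"
  by (simp add: pattern_at_def)

lemma pattern_at_oneD: "pattern_at s j i x \<Longrightarrow> s + j \<le> r \<Longrightarrow> r < s + j + i \<Longrightarrow> x r = 1"
  by (simp add: pattern_at_def)

text \<open>Reading backwards from the common final zero, the run of ones determines
  \<open>i\<close>, and the maximal run of zeros before it determines \<open>j\<close> and
  \<open>s\<close>. Hence at most one occurrence ends at each time.\<close>

lemma pattern_at_unique:
  assumes "pattern_at s j i x" "pattern_at s' j' i' x" "s + j + i = s' + j' + i'"
    and "1 \<le> s" "1 \<le> s'" "1 \<le> j" "1 \<le> j'"
  shows "s = s' \<and> j = j' \<and> i = i'"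
proof -
  have i: "i \<le> i'"
    if "pattern_at s j i x" "pattern_at s' j' i' x" "s + j + i = s' + j' + i'" "1 \<le> j'"
    for s j i s' j' i'
  proof (rule ccontr)
    assume "\<not> i \<le> i'"
    \<comment> \<open>The last zero of the second pattern, at \<open>s' + j' - 1\<close>, would lie
      among the ones of the first.\<close>
    with that(3,4) have "s + j \<le> s' + j' - 1" "s' + j' - 1 < s + j + i"
      "s' \<le> s' + j' - 1" "s' + j' - 1 < s' + j'"
      by linarith+
    with pattern_at_oneD[OF that(1)] pattern_at_zeroD[OF that(2)] show False by fastforce
  qed
  have ii: "i = i'"
    using i[OF assms(1,2,3,7)] i[OF assms(2,1) assms(3)[symmetric] assms(6)] by simp
  have s: "s \<le> s'"
    if "pattern_at s j i x" "pattern_at s' j' i x" "s + j = s' + j'" "1 \<le> s'"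
    for s j s' j'
  proof (rule ccontr)
    assume c: "\<not> s \<le> s'"
    \<comment> \<open>Position \<open>s - 1\<close> would be a zero of the second pattern, while the
      block of zeros starting at \<open>s > 1\<close> must be preceded by a one.\<close>
    then have "s' \<le> s - 1" "s - 1 < s' + j'" using that(3) by linarith+
    then have "x (s - 1) = 0" by (rule pattern_at_zeroD[OF that(2)])
    with that(1) c \<open>1 \<le> s'\<close> show False by (simp add: pattern_at_def)
  qed
  have "s = s'"
    using s[of s j s' j'] s[of s' j' s j] assms(1-5) ii by simp
  with ii assms(3) show ?thesis by simp
qed

text \<open>This is the conditioning on the run lengths, carried out path by path: at most one term
  is nonzero, because at most one pattern ends at \<open>n\<close>. The count is evaluated at the
  start \<open>n - i - j\<close> of the zero block instead of at \<open>n - 1\<close>. Its value is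
  the same there, and it depends only on trials up to that start, so that the rest of the pattern
  will be independent of it. The factor \<open>of_bool (i + j < n)\<close> excludes the pairs for
  which truncated subtraction gives the start 0.\<close>

lemma H_diff_eq_sum_pattern:
  fixes h :: "nat \<Rightarrow> real"
  assumes l: "1 \<le> l1" "1 \<le> l2" and n: "1 \<le> n"
  shows "h (H l1 k1 l2 k2 n x) - h (H l1 k1 l2 k2 (n - 1) x) =
    (\<Sum>(j, i)\<in>{l1..k1} \<times> {l2..k2}. of_bool (i + j < n) *
       ((h (Suc (H l1 k1 l2 k2 (n - i - j) x)) - h (H l1 k1 l2 k2 (n - i - j) x)) *
        of_bool (pattern_at (n - i - j) j i x)))"
    (is "?L = (\<Sum>(j, i)\<in>?J. ?t j i)")
proof (cases "\<exists>j i. (j, i) \<in> ?J \<and> i + j < n \<and> pattern_at (n - i - j) j i x")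
  case False
  then have "?t j i = 0" if "(j, i) \<in> ?J" for j i using that by auto
  then have R: "(\<Sum>(j, i)\<in>?J. ?t j i) = 0" by (intro sum.neutral) auto
  have "occurrences l1 k1 l2 k2 n x = occurrences l1 k1 l2 k2 (n - 1) x"
  proof -
    have "s + j + i \<noteq> n" if "(s, j, i) \<in> occurrences l1 k1 l2 k2 n x" for s j i
    proof
      assume e: "s + j + i = n"
      then have s: "s = n - i - j" "i + j < n"
        using that by (auto simp: occurrences_def)
      have "(j, i) \<in> ?J" "pattern_at s j i x"
        using that by (auto simp: occurrences_def pattern_at_def)
      with False s show False by blast
    qed
    then show ?thesis by (fastforce simp: occurrences_def)
  qed
  with R show ?thesis by (simp add: H_def)
next
  case True
  then obtain j i where ji: "(j, i) \<in> ?J" "i + j < n" and pat: "pattern_at (n - i - j) j i x"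
    by blast
  define s where "s = n - i - j"
  have n_eq: "n = s + j + i" and s1: "1 \<le> s" using ji by (auto simp: s_def)
  have pat: "pattern_at s j i x" using pat by (simp add: s_def)
  have j1: "1 \<le> j" and i1: "1 \<le> i" using ji l by auto
  have uniq: "j' = j \<and> i' = i"
    if "(j', i') \<in> ?J" "i' + j' < n" "pattern_at (n - i' - j') j' i' x" for j' i'
  proof -
    have "n - i' - j' + j' + i' = s + j + i" "1 \<le> n - i' - j'" "1 \<le> j'"
      using that(1,2) n_eq l by auto
    with pattern_at_unique[OF that(3) pat] s1 j1 show ?thesis by blast
  qed
  have "(\<Sum>(j', i')\<in>?J. ?t j' i') = (\<Sum>p\<in>?J. if p = (j, i) then ?t j i else 0)"
  proof (rule sum.cong[OF refl], clarify)
    fix j' i' assume "j' \<in> {l1..k1}" "i' \<in> {l2..k2}"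
    then have "j' = j \<and> i' = i" if "i' + j' < n" "pattern_at (n - i' - j') j' i' x"
      using uniq that by blast
    then show "?t j' i' = (if (j', i') = (j, i) then ?t j i else 0)"
      by (cases "i' + j' < n \<and> pattern_at (n - i' - j') j' i' x") auto
  qed
  also have "\<dots> = ?t j i" using ji by simp
  also have "\<dots> = h (Suc (H l1 k1 l2 k2 s x)) - h (H l1 k1 l2 k2 s x)"
    using ji pat by (simp add: s_def)
  finally have R: "(\<Sum>(j', i')\<in>?J. ?t j' i') = h (Suc (H l1 k1 l2 k2 s x)) - h (H l1 k1 l2 k2 s x)" .
  have zero: "x r = 0" if "r \<in> {s..<s + j}" for r
    using pat that by (simp add: pattern_at_zeroD)
  have one: "x r = 1" if "r \<in> {s + j..<s + j + i}" for r
    using pat that by (simp add: pattern_at_oneD)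
  \<comment> \<open>From \<open>s\<close> to \<open>n - 1\<close> the trials are \<open>j\<close>
    zeros and then \<open>i\<close> ones, so no zero after position \<open>s\<close> in this range
    follows a one.\<close>
  have Hs: "H l1 k1 l2 k2 (n - 1) x = H l1 k1 l2 k2 s x"
  proof (rule H_eq_if_no_end[OF l(2)])
    show "s \<le> n - 1" using n_eq j1 by auto
    fix e assume e: "s < e" "e \<le> n - 1" "x e = 0"
    have "e < s + j"
    proof (rule ccontr)
      assume "\<not> e < s + j"
      then have "e \<in> {s + j..<s + j + i}" using e n_eq n by auto
      with one e show False by force
    qed
    with e have "e - 1 \<in> {s..<s + j}" by auto
    with zero show "x (e - 1) \<noteq> 1" by force
  qed
  have "occurrences l1 k1 l2 k2 n x = insert (s, j, i) (occurrences l1 k1 l2 k2 (n - 1) x)"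
  proof (intro equalityI subsetI)
    fix o' assume o: "o' \<in> occurrences l1 k1 l2 k2 n x"
    obtain s' j' i' where o': "o' = (s', j', i')" by (cases o')
    show "o' \<in> insert (s, j, i) (occurrences l1 k1 l2 k2 (n - 1) x)"
    proof (cases "s' + j' + i' = n")
      case True
      have "pattern_at s' j' i' x" "1 \<le> s'" "1 \<le> j'"
        using o o' l by (auto simp: occurrences_def pattern_at_def)
      with pattern_at_unique[OF pat this(1)] True n_eq s1 j1 o' show ?thesis by auto
    next
      case False
      with o o' show ?thesis by (auto simp: occurrences_def)
    qed
  next
    fix o' assume "o' \<in> insert (s, j, i) (occurrences l1 k1 l2 k2 (n - 1) x)"
    then show "o' \<in> occurrences l1 k1 l2 k2 n x"
      using pat ji n_eq s1 by (auto simp: occurrences_def pattern_at_def)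
  qed
  moreover have "(s, j, i) \<notin> occurrences l1 k1 l2 k2 (n - 1) x"
    using n_eq n by (auto simp: occurrences_def)
  ultimately have "H l1 k1 l2 k2 n x = Suc (H l1 k1 l2 k2 (n - 1) x)"
    by (simp add: H_def)
  with Hs R show ?thesis by simp
qed

section \<open>Functionals of finitely many trials\<close>

text \<open>Dependence on finitely many trials will give measurability, and the finite range
  boundedness; together they make every such functional integrable.\<close>

definition cylinder :: "nat \<Rightarrow> ((nat \<Rightarrow> nat) \<Rightarrow> real) \<Rightarrow> bool" where
  "cylinder n F \<longleftrightarrow>
     finite (range F) \<and> (\<forall>x y. (\<forall>r\<in>{1..n}. x r = y r) \<longrightarrow> F x = F y)"

lemma cylinderI:
  assumes "finite (range F)"
    and "\<And>x y. (\<And>r. 1 \<le> r \<Longrightarrow> r \<le> n \<Longrightarrow> x r = y r) \<Longrightarrow> F x = F y"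
  shows "cylinder n F"
  unfolding cylinder_def
proof (intro conjI allI impI)
  fix x y :: "nat \<Rightarrow> nat" assume "\<forall>r\<in>{1..n}. x r = y r"
  then show "F x = F y" by (intro assms(2)) auto
qed (rule assms(1))

lemma cylinderD:
  assumes "cylinder n F" and "\<And>r. 1 \<le> r \<Longrightarrow> r \<le> n \<Longrightarrow> x r = y r"
  shows "F x = F y"
  using assms by (simp add: cylinder_def)

lemma cylinder_finite: "cylinder n F \<Longrightarrow> finite (range F)"
  by (simp add: cylinder_def)

lemma cylinder_mono: "cylinder m F \<Longrightarrow> m \<le> n \<Longrightarrow> cylinder n F"
  by (auto simp: cylinder_def)

lemma cylinder_mult:
  assumes F: "cylinder n F" and G: "cylinder n G"
  shows "cylinder n (\<lambda>x. F x * G x)"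
proof (rule cylinderI)
  have "range (\<lambda>x. F x * G x) \<subseteq> (\<lambda>(a, b). a * b) ` (range F \<times> range G)" by auto
  moreover have "finite ((\<lambda>(a, b). a * b) ` (range F \<times> range G))"
    using cylinder_finite[OF F] cylinder_finite[OF G] by simp
  ultimately show "finite (range (\<lambda>x. F x * G x))" by (rule finite_subset)
next
  fix x y :: "nat \<Rightarrow> nat" assume "\<And>r. 1 \<le> r \<Longrightarrow> r \<le> n \<Longrightarrow> x r = y r"
  with cylinderD[OF F] cylinderD[OF G] show "F x * G x = F y * G y" by metis
qed

lemma cylinder_of_bool:
  assumes "\<And>x y. (\<And>r. 1 \<le> r \<Longrightarrow> r \<le> n \<Longrightarrow> x r = y r) \<Longrightarrow> Q x \<longleftrightarrow> Q y"
  shows "cylinder n (\<lambda>x. of_bool (Q x))"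
proof (rule cylinderI)
  show "finite (range (\<lambda>x. of_bool (Q x) :: real))"
    by (rule finite_subset[of _ "{0, 1}"]) (auto simp: of_bool_def)
qed (rule arg_cong[of _ _ of_bool], rule assms)

lemma cylinder_H: "cylinder n (\<lambda>x. h (H l1 k1 l2 k2 n x))"
proof (rule cylinderI)
  have "range (\<lambda>x. h (H l1 k1 l2 k2 n x)) \<subseteq> h ` {..card ({1..n} \<times> {..n} \<times> {..n})}"
    using H_le by blast
  then show "finite (range (\<lambda>x. h (H l1 k1 l2 k2 n x)))"
    by (rule finite_subset) auto
qed (rule arg_cong[of _ _ h], rule H_cong)

section \<open>Expectations under independent trials\<close>

locale bernoulli_sequence = prob_space M for M :: "'a measure" +
  fixes \<zeta> :: "nat \<Rightarrow> 'a \<Rightarrow> nat" and p q :: real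
  assumes indep: "indep_vars (\<lambda>_. count_space UNIV) \<zeta> {1..}"
    and prob_one: "1 \<le> i \<Longrightarrow> prob {\<omega> \<in> space M. \<zeta> i \<omega> = 1} = p"
    and prob_zero: "1 \<le> i \<Longrightarrow> prob {\<omega> \<in> space M. \<zeta> i \<omega> = 0} = q"
    and q_def: "q = 1 - p"
begin

definition Ex :: "((nat \<Rightarrow> nat) \<Rightarrow> real) \<Rightarrow> real" where
  "Ex F = expectation (\<lambda>\<omega>. F (\<lambda>i. \<zeta> i \<omega>))"

lemma measurable_trial [measurable]: "1 \<le> i \<Longrightarrow> \<zeta> i \<in> M \<rightarrow>\<^sub>M count_space UNIV"
  using indep by (auto simp: indep_vars_def)

text \<open>A finite product of countable discrete spaces is discrete, so every function of the
  first \<open>n\<close> trials is measurable.\<close>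

lemma PiM_trials: "(\<Pi>\<^sub>M i\<in>{1..n::nat}. count_space (UNIV :: nat set)) = count_space ({1..n} \<rightarrow>\<^sub>E UNIV)"
  by (rule count_space_PiM_finite) auto

lemma cylinder_restrict: "cylinder n F \<Longrightarrow> F x = F (restrict x {1..n})"
  by (auto simp: cylinder_def)

lemma cylinder_integrable:
  assumes "cylinder n F"
  shows "integrable M (\<lambda>\<omega>. F (\<lambda>i. \<zeta> i \<omega>))"
proof -
  have r: "(\<lambda>\<omega>. \<lambda>i\<in>{1..n}. \<zeta> i \<omega>) \<in> M \<rightarrow>\<^sub>M count_space ({1..n} \<rightarrow>\<^sub>E UNIV)"
    unfolding PiM_trials[symmetric] by (rule measurable_restrict) auto
  have "F \<in> borel_measurable (count_space ({1..n} \<rightarrow>\<^sub>E UNIV))" by simp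
  from measurable_compose[OF r this]
  have m: "(\<lambda>\<omega>. F (\<lambda>i. \<zeta> i \<omega>)) \<in> borel_measurable M"
    by (subst cylinder_restrict[OF assms]) simp
  have "bounded (range F)" using assms by (auto simp: cylinder_def intro: finite_imp_bounded)
  then obtain B where "\<And>x. norm (F x) \<le> B" by (auto simp: bounded_iff)
  then show ?thesis using m by (intro integrable_const_bound[of _ B]) auto
qed

text \<open>The trials take values in \<open>nat\<close>, but the probabilities of 0 and 1 already
  add up to 1.\<close>

lemma AE_trial: "1 \<le> i \<Longrightarrow> AE \<omega> in M. \<zeta> i \<omega> = 0 \<or> \<zeta> i \<omega> = 1"
proof -
  assume i: "1 \<le> i"
  have [measurable]: "{\<omega> \<in> space M. \<zeta> i \<omega> = c} \<in> events" for c
    using measurable_trial[OF i] by measurable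
  have "prob ({\<omega> \<in> space M. \<zeta> i \<omega> = 0} \<union> {\<omega> \<in> space M. \<zeta> i \<omega> = 1}) = q + p"
    using prob_one[OF i] prob_zero[OF i] by (subst finite_measure_Union) auto
  then have "prob ({\<omega> \<in> space M. \<zeta> i \<omega> = 0} \<union> {\<omega> \<in> space M. \<zeta> i \<omega> = 1}) = 1"
    by (simp add: q_def)
  then have "AE \<omega> in M. \<omega> \<in> {\<omega> \<in> space M. \<zeta> i \<omega> = 0} \<union> {\<omega> \<in> space M. \<zeta> i \<omega> = 1}"
    by (subst (asm) prob_eq_1) auto
  then show ?thesis by eventually_elim auto
qed

lemma Ex_split:
  assumes F: "cylinder n F" and r: "1 \<le> r" "r \<le> n"
  shows "Ex F = Ex (\<lambda>x. F x * of_bool (x r = 0)) + Ex (\<lambda>x. F x * of_bool (x r = 1))"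
proof -
  have i: "integrable M (\<lambda>\<omega>. F (\<lambda>i. \<zeta> i \<omega>) * of_bool (\<zeta> r \<omega> = c))" for c
    by (rule cylinder_integrable[OF cylinder_mult[OF F cylinder_of_bool]]) (use r in auto)
  have "Ex F = expectation (\<lambda>\<omega>. F (\<lambda>i. \<zeta> i \<omega>) * of_bool (\<zeta> r \<omega> = 0) + F (\<lambda>i. \<zeta> i \<omega>) * of_bool (\<zeta> r \<omega> = 1))"
    unfolding Ex_def
  proof (rule integral_cong_AE)
    show "AE \<omega> in M. F (\<lambda>i. \<zeta> i \<omega>) =
      F (\<lambda>i. \<zeta> i \<omega>) * of_bool (\<zeta> r \<omega> = 0) + F (\<lambda>i. \<zeta> i \<omega>) * of_bool (\<zeta> r \<omega> = 1)"
      using AE_trial[OF r(1)] by eventually_elim auto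
  qed (use cylinder_integrable[OF F] i[of 0] i[of 1] in \<open>auto intro: borel_measurable_add\<close>)
  also have "\<dots> = Ex (\<lambda>x. F x * of_bool (x r = 0)) + Ex (\<lambda>x. F x * of_bool (x r = 1))"
    unfolding Ex_def by (rule Bochner_Integration.integral_add[OF i i])
  finally show ?thesis .
qed

definition weight :: "nat \<Rightarrow> real" where
  "weight c = (if c = 0 then q else p)"

lemma Ex_next_trial:
  assumes F: "cylinder n F" and c: "c \<in> {0, 1}"
  shows "Ex (\<lambda>x. F x * of_bool (x (Suc n) = c)) = Ex F * weight c"
proof -
  let ?C = "\<lambda>_. count_space UNIV :: nat measure"
  \<comment> \<open>The index sets \<open>{1..n}\<close> and \<open>{Suc n}\<close> are disjoint, so
    the two tuples of trials are independent; \<open>F\<close> is a function of the first and the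
    indicator a function of the second.\<close>
  have "indep_var (PiM {1..n} ?C) (\<lambda>\<omega>. \<lambda>i\<in>{1..n}. \<zeta> i \<omega>) (PiM {Suc n} ?C) (\<lambda>\<omega>. \<lambda>i\<in>{Suc n}. \<zeta> i \<omega>)"
    by (rule indep_var_restrict[OF indep]) auto
  moreover have "F \<in> PiM {1..n} ?C \<rightarrow>\<^sub>M borel" unfolding PiM_trials by simp
  moreover have "(\<lambda>x. of_bool (x (Suc n) = c)) \<in> PiM {Suc n} ?C \<rightarrow>\<^sub>M (borel :: real measure)"
    by measurable
  ultimately have "indep_var borel (F \<circ> (\<lambda>\<omega>. \<lambda>i\<in>{1..n}. \<zeta> i \<omega>))
      borel ((\<lambda>x. of_bool (x (Suc n) = c)) \<circ> (\<lambda>\<omega>. \<lambda>i\<in>{Suc n}. \<zeta> i \<omega>) :: 'a \<Rightarrow> real)"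
    by (rule indep_var_compose)
  moreover have "F \<circ> (\<lambda>\<omega>. \<lambda>i\<in>{1..n}. \<zeta> i \<omega>) = (\<lambda>\<omega>. F (\<lambda>i. \<zeta> i \<omega>))"
    by (simp only: comp_def cylinder_restrict[OF F, symmetric])
  moreover have "(\<lambda>x. of_bool (x (Suc n) = c)) \<circ> (\<lambda>\<omega>. \<lambda>i\<in>{Suc n}. \<zeta> i \<omega>) =
      (\<lambda>\<omega>. of_bool (\<zeta> (Suc n) \<omega> = c) :: real)"
    by (simp add: comp_def)
  ultimately have ind: "indep_var borel (\<lambda>\<omega>. F (\<lambda>i. \<zeta> i \<omega>)) borel (\<lambda>\<omega>. of_bool (\<zeta> (Suc n) \<omega> = c) :: real)"
    by simp
  have b: "cylinder (Suc n) (\<lambda>x. of_bool (x (Suc n) = c))"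
    by (rule cylinder_of_bool) auto
  have "expectation (\<lambda>\<omega>. of_bool (\<zeta> (Suc n) \<omega> = c) :: real) =
      expectation (indicator {\<omega> \<in> space M. \<zeta> (Suc n) \<omega> = c})"
    by (rule Bochner_Integration.integral_cong) (auto simp: indicator_def)
  also have "\<dots> = prob {\<omega> \<in> space M. \<zeta> (Suc n) \<omega> = c}"
    by (auto intro!: arg_cong[of _ _ prob])
  also have "\<dots> = weight c"
    using c prob_one[of "Suc n"] prob_zero[of "Suc n"] by (auto simp: weight_def)
  finally show ?thesis
    using indep_var_lebesgue_integral[OF ind cylinder_integrable[OF F] cylinder_integrable[OF b]]
    by (simp add: Ex_def)
qed

lemma Ex_run:
  assumes F: "cylinder n F" and c: "c \<in> {0, 1}"
  shows "Ex (\<lambda>x. F x * of_bool (\<forall>r\<in>{n<..n + d}. x r = c)) = Ex F * weight c ^ d"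
proof (induction d)
  case (Suc d)
  have cyl: "cylinder (n + d) (\<lambda>x. F x * of_bool (\<forall>r\<in>{n<..n + d}. x r = c))"
    by (rule cylinder_mult[OF cylinder_mono[OF F] cylinder_of_bool]) auto
  have "{n<..n + Suc d} = insert (Suc (n + d)) {n<..n + d}" by auto
  then have "(\<lambda>x. F x * of_bool (\<forall>r\<in>{n<..n + Suc d}. x r = c)) =
      (\<lambda>x. F x * of_bool (\<forall>r\<in>{n<..n + d}. x r = c) * of_bool (x (Suc (n + d)) = c))"
    by (auto simp: fun_eq_iff)
  then show ?case using Ex_next_trial[OF cyl c] Suc by simp
qed simp

text \<open>The first zero of the block and the condition on the trial before it are kept in the
  expectation, since they may depend on \<open>F\<close>. The later trials are fresh:
  \<open>j - 1\<close> zeros, \<open>i\<close> ones and the closing zero. The closing zero supplies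
  the missing factor, whence \<open>q ^ j\<close> in total.\<close>

lemma Ex_pattern:
  assumes F: "cylinder s F" and s: "1 \<le> s" and j: "1 \<le> j" and i: "1 \<le> i"
  shows "Ex (\<lambda>x. F x * of_bool (pattern_at s j i x)) =
    q ^ j * p ^ i * Ex (\<lambda>x. F x * of_bool (x s = 0 \<and> (s = 1 \<or> x (s - 1) = 1)))"
proof -
  define F0 where "F0 = (\<lambda>x. F x * of_bool (x s = 0 \<and> (s = 1 \<or> x (s - 1) = 1)))"
  define F1 where "F1 = (\<lambda>x. F0 x * of_bool (\<forall>r\<in>{s<..s + (j - 1)}. x r = 0))"
  define F2 where "F2 = (\<lambda>x. F1 x * of_bool (\<forall>r\<in>{s + (j - 1)<..s + (j - 1) + i}. x r = 1))"
  have 0: "cylinder s F0"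
    unfolding F0_def
  proof (rule cylinder_mult[OF F cylinder_of_bool])
    fix x y :: "nat \<Rightarrow> nat" assume xy: "\<And>r. 1 \<le> r \<Longrightarrow> r \<le> s \<Longrightarrow> x r = y r"
    have "s = 1 \<or> x (s - 1) = y (s - 1)" using s by (cases "s = 1") (auto intro!: xy)
    then show "(x s = 0 \<and> (s = 1 \<or> x (s - 1) = 1)) = (y s = 0 \<and> (s = 1 \<or> y (s - 1) = 1))"
      using xy[of s] s by auto
  qed
  have 1: "cylinder (s + (j - 1)) F1"
    unfolding F1_def by (rule cylinder_mult[OF cylinder_mono[OF 0] cylinder_of_bool]) auto
  have 2: "cylinder (s + (j - 1) + i) F2"
    unfolding F2_def by (rule cylinder_mult[OF cylinder_mono[OF 1] cylinder_of_bool]) auto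
  have sets: "{s..<s + j} = insert s {s<..s + (j - 1)}" "{s + j..<s + j + i} = {s + (j - 1)<..s + (j - 1) + i}"
    "Suc (s + (j - 1) + i) = s + j + i"
    using j by auto
  have "(\<lambda>x. F x * of_bool (pattern_at s j i x)) = (\<lambda>x. F2 x * of_bool (x (Suc (s + (j - 1) + i)) = 0))"
    unfolding F2_def F1_def F0_def pattern_at_def sets by (auto simp: fun_eq_iff)
  then have "Ex (\<lambda>x. F x * of_bool (pattern_at s j i x)) =
      Ex (\<lambda>x. F2 x * of_bool (x (Suc (s + (j - 1) + i)) = 0))"
    by simp
  also have "\<dots> = Ex F2 * q"
    by (subst Ex_next_trial[OF 2]) (auto simp: weight_def)
  also have "Ex F2 = Ex F1 * p ^ i"
    unfolding F2_def by (subst Ex_run[OF 1]) (auto simp: weight_def)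
  also have "Ex F1 = Ex F0 * q ^ (j - 1)"
    unfolding F1_def by (subst Ex_run[OF 0]) (auto simp: weight_def)
  finally show ?thesis
    using j by (cases j) (simp_all add: F0_def)
qed

end

section \<open>The recurrence for a general functional of the count\<close>

lemma telescope_geometric:
  fixes f :: "int \<Rightarrow> real"
  assumes "l \<le> k"
  shows "(\<Sum>j=l..k. c ^ j * (f (u - int j) - c * f (u - int j - 1))) =
    c ^ l * f (u - int l) - c ^ (Suc k) * f (u - int k - 1)"
  using assms
proof (induction k rule: dec_induct)
  case (step k)
  have "u - int (Suc k) = u - int k - 1" by simp
  then show ?case using step by (simp add: algebra_simps)
qed (simp add: algebra_simps)

text \<open>The sum over \<open>j\<close> telescopes by the relation between \<open>g\<close> and
  \<open>f\<close>, the sum over \<open>i\<close> by the one between \<open>f\<close> and \<phi>.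
  The two end points of each sum combine to the four terms in \<phi>. The defect \<open>d\<close> at
  \<open>s = 0\<close> does not telescope and leaves one contribution for each end point of the sum
  over \<open>j\<close>.\<close>

lemma double_telescope:
  fixes \<phi> :: "int \<Rightarrow> real" and n l1 k1 l2 k2 :: nat
  assumes f: "\<And>s. f s = \<phi> s - p * \<phi> (s - 1) - d * of_bool (s = 0)"
    and g: "\<And>s. g s = f s - q * f (s - 1)"
    and le: "l1 \<le> k1" "l2 \<le> k2" and n: "l1 + l2 + 1 \<le> n" and "0 < p"
    and l: "l = l1 + l2" "m1 = k1 - l1 + 1" "m2 = k2 - l2 + 1" "a = q ^ l1 * p ^ l2"
  shows "(\<Sum>j=l1..k1. \<Sum>i=l2..k2. q ^ j * p ^ i * g (int n - int i - int j)) =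
     a * (\<phi> (int n - int l) - q ^ m1 * \<phi> (int n - int l - int m1)
        - p ^ m2 * \<phi> (int n - int l - int m2)
        + q ^ m1 * p ^ m2 * \<phi> (int n - int l - int m1 - int m2))
     - a * p ^ (n - l) * d *
        (of_bool (l + 1 \<le> n \<and> n \<le> l + m2 - 1)
         - (q / p) ^ m1 * of_bool (l + m1 \<le> n \<and> n \<le> l + m1 + m2 - 1))"
proof -
  have inner: "(\<Sum>i=l2..k2. p ^ i * f (u - int i)) =
      p ^ l2 * \<phi> (u - int l2) - p ^ (Suc k2) * \<phi> (u - int k2 - 1)
      - d * (if int l2 \<le> u \<and> u \<le> int k2 then p ^ nat u else 0)" for u
  proof -
    \<comment> \<open>The defect enters only at the index \<open>i = u\<close>, where the argument
      of \<open>f\<close> is 0, and only if this index is in the range of summation.\<close>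
    have "(\<Sum>i=l2..k2. p ^ i * f (u - int i)) =
       (\<Sum>i=l2..k2. p ^ i * (\<phi> (u - int i) - p * \<phi> (u - int i - 1)) - d * (if u = int i then p ^ i else 0))"
      by (rule sum.cong) (auto simp: f algebra_simps)
    also have "\<dots> = p ^ l2 * \<phi> (u - int l2) - p ^ (Suc k2) * \<phi> (u - int k2 - 1)
       - d * (\<Sum>i=l2..k2. if u = int i then p ^ i else 0)"
      by (simp only: sum_subtractf telescope_geometric[OF le(2)] sum_distrib_left)
    also have "(\<Sum>i=l2..k2. if u = int i then p ^ i else 0) =
        (\<Sum>i=l2..k2. if i = nat u \<and> 0 \<le> u then p ^ nat u else 0)"
      by (rule sum.cong) auto
    also have "\<dots> = (if int l2 \<le> u \<and> u \<le> int k2 then p ^ nat u else 0)"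
      by (cases "0 \<le> u") (auto simp: sum.delta)
    finally show ?thesis .
  qed
  have eqs: "int n - int l1 - int l2 = int n - int l" "int n - int l1 - int k2 - 1 = int n - int l - int m2"
    "int n - int k1 - 1 - int l2 = int n - int l - int m1"
    "int n - int k1 - 1 - int k2 - 1 = int n - int l - int m1 - int m2"
    "Suc k1 = l1 + m1" "Suc k2 = l2 + m2"
    using le l by auto
  \<comment> \<open>Summing over \<open>j\<close> first leaves two sums over \<open>i\<close>, to
    which \<open>inner\<close> applies with \<open>u = n - l1\<close> and
    \<open>u = n - k1 - 1\<close>.\<close>
  have "(\<Sum>j=l1..k1. \<Sum>i=l2..k2. q ^ j * p ^ i * g (int n - int i - int j)) =
      (\<Sum>i=l2..k2. p ^ i * (\<Sum>j=l1..k1. q ^ j * g (int n - int i - int j)))"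
    by (subst sum.swap) (simp add: sum_distrib_left mult_ac)
  also have "\<dots> = (\<Sum>i=l2..k2. p ^ i * (q ^ l1 * f (int n - int i - int l1)
       - q ^ (Suc k1) * f (int n - int i - int k1 - 1)))"
    by (simp only: g telescope_geometric[OF le(1)])
  also have "\<dots> = q ^ l1 * (\<Sum>i=l2..k2. p ^ i * f ((int n - int l1) - int i))
       - q ^ (Suc k1) * (\<Sum>i=l2..k2. p ^ i * f ((int n - int k1 - 1) - int i))"
    by (simp add: sum_distrib_left right_diff_distrib sum_subtractf diff_diff_eq add_ac mult_ac)
  also have "\<dots> = q ^ l1 * (p ^ l2 * \<phi> (int n - int l1 - int l2)
         - p ^ (Suc k2) * \<phi> (int n - int l1 - int k2 - 1))
       - q ^ (Suc k1) * (p ^ l2 * \<phi> (int n - int k1 - 1 - int l2)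
         - p ^ (Suc k2) * \<phi> (int n - int k1 - 1 - int k2 - 1))
       - d * (q ^ l1 * (if int l2 \<le> int n - int l1 \<and> int n - int l1 \<le> int k2 then p ^ nat (int n - int l1) else 0)
            - q ^ (Suc k1) * (if int l2 \<le> int n - int k1 - 1 \<and> int n - int k1 - 1 \<le> int k2
                 then p ^ nat (int n - int k1 - 1) else 0))"
    by (simp only: inner) (simp add: algebra_simps)
  \<comment> \<open>Defect for \<open>u = n - l1\<close>: since \<open>k2 = l2 + m2 - 1\<close>, the
    bound \<open>u \<le> k2\<close> means \<open>n \<le> l + m2 - 1\<close>.\<close>
  also have "q ^ l1 * (if int l2 \<le> int n - int l1 \<and> int n - int l1 \<le> int k2 then p ^ nat (int n - int l1) else 0)
      = a * p ^ (n - l) * of_bool (l + 1 \<le> n \<and> n \<le> l + m2 - 1)"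
  proof -
    have "nat (int n - int l1) = l2 + (n - l)" using n l by auto
    then have "q ^ l1 * p ^ nat (int n - int l1) = a * p ^ (n - l)"
      using l(4) by (simp only: power_add mult.assoc)
    moreover have "int l2 \<le> int n - int l1 \<and> int n - int l1 \<le> int k2 \<longleftrightarrow> l + 1 \<le> n \<and> n \<le> l + m2 - 1"
      using n le l by auto
    ultimately show ?thesis by simp
  qed
  \<comment> \<open>Defect for \<open>u = n - k1 - 1\<close>, where \<open>k1 + 1 = l1 + m1\<close>.
    The power of \<open>p\<close> is \<open>l2 + (n - l - m1)\<close>; writing it with
    \<open>p ^ (n - l)\<close> requires division by \<open>p ^ m1\<close>, which yields the power of
    \<open>q / p\<close>.\<close>
  also have "q ^ (Suc k1) * (if int l2 \<le> int n - int k1 - 1 \<and> int n - int k1 - 1 \<le> int k2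
                 then p ^ nat (int n - int k1 - 1) else 0)
      = a * p ^ (n - l) * ((q / p) ^ m1 * of_bool (l + m1 \<le> n \<and> n \<le> l + m1 + m2 - 1))"
  proof (cases "l + m1 \<le> n \<and> n \<le> l + m1 + m2 - 1")
    case True
    then have "n - l = m1 + (n - l - m1)" "nat (int n - int k1 - 1) = l2 + (n - l - m1)" "Suc k1 = l1 + m1"
      using le l by auto
    then have "q ^ Suc k1 * p ^ nat (int n - int k1 - 1) = a * p ^ (n - l) * (q / p) ^ m1"
      using \<open>0 < p\<close> l(4) by (simp only: power_add power_divide) (simp add: power_add)
    with True le l show ?thesis by auto
  next
    case False
    with le l show ?thesis by auto
  qed
  finally show ?thesis
    unfolding eqs l(4) power_add by (simp add: algebra_simps)
qed

section \<open>Expectations of functions of the count\<close>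

locale pattern_count = bernoulli_sequence +
  fixes l1 k1 l2 k2 :: nat
  assumes l1: "1 \<le> l1" and l2: "1 \<le> l2"
begin

abbreviation N :: "nat \<Rightarrow> (nat \<Rightarrow> nat) \<Rightarrow> nat" where
  "N \<equiv> H l1 k1 l2 k2"

definition Phi :: "(nat \<Rightarrow> real) \<Rightarrow> int \<Rightarrow> real" where
  "Phi h n = (if n < 0 then 0 else Ex (\<lambda>x. h (N (nat n) x)))"

text \<open>For \<open>h = D\<close> this is the \<open>f\<close> of the opening explanation. Its
  value at time 0 is 0 because there is no trial 0, whereas \<open>Phi h 0 = h 0\<close>; this
  mismatch is the defect.\<close>

definition Phi_zero :: "(nat \<Rightarrow> real) \<Rightarrow> int \<Rightarrow> real" where
  "Phi_zero h n = (if n \<le> 0 then 0 else Ex (\<lambda>x. h (N (nat n) x) * of_bool (x (nat n) = 0)))"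

text \<open>For \<open>h = D\<close> this is the \<open>g\<close> of the opening explanation. The
  value 0 at non-positive times lets sums over run lengths include pairs that do not fit before time
  \<open>n\<close>.\<close>

definition Phi_start :: "(nat \<Rightarrow> real) \<Rightarrow> int \<Rightarrow> real" where
  "Phi_start h n = (if n \<le> 0 then 0 else Ex (\<lambda>x. h (N (nat n) x) *
     of_bool (x (nat n) = 0 \<and> (nat n = 1 \<or> x (nat n - 1) = 1))))"

lemma Phi_initial: "0 \<le> n \<Longrightarrow> n \<le> int (l1 + l2) \<Longrightarrow> Phi h n = h 0"
  by (simp add: Phi_def Ex_def H_eq_0 prob_space)

lemma Phi_add: "Phi (\<lambda>m. g m + h m) n = Phi g n + Phi h n"
  using cylinder_integrable[OF cylinder_H] by (simp add: Phi_def Ex_def)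

lemma Phi_diff: "Phi (\<lambda>m. g m - h m) n = Phi g n - Phi h n"
  using cylinder_integrable[OF cylinder_H] by (simp add: Phi_def Ex_def)

lemma Phi_cmult: "Phi (\<lambda>m. c * h m) n = c * Phi h n"
  by (simp add: Phi_def Ex_def)

lemma Phi_sum: "finite A \<Longrightarrow> Phi (\<lambda>m. \<Sum>k\<in>A. h k m) n = (\<Sum>k\<in>A. Phi (h k) n)"
  by (induction A rule: finite_induct) (simp_all add: Phi_add, simp add: Phi_def Ex_def)

text \<open>For \<open>s \<ge> 1\<close> split according to trial \<open>s\<close>. A one completes
  nothing, so on that event the count is the one at \<open>s - 1\<close>, which is independent of
  trial \<open>s\<close>. At \<open>s = 0\<close> the left side is 0 and
  \<open>Phi h 0 = h 0\<close> has to be removed.\<close>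

lemma Phi_zero_eq: "Phi_zero h s = Phi h s - p * Phi h (s - 1) - h 0 * of_bool (s = 0)"
proof (cases "s \<le> 0")
  case True
  then show ?thesis using Phi_initial[of 0 h]
    by (cases "s = 0") (auto simp: Phi_zero_def Phi_def)
next
  case False
  then have "s = int (Suc (nat (s - 1)))" by simp
  then obtain n where s: "s = int (Suc n)" by blast
  have "Phi h s = Phi_zero h s + Ex (\<lambda>x. h (N (Suc n) x) * of_bool (x (Suc n) = 1))"
    using Ex_split[OF cylinder_H[of "Suc n" h l1 k1 l2 k2], of "Suc n"]
    by (simp add: Phi_def Phi_zero_def s nat_add_distrib)
  also have "(\<lambda>x. h (N (Suc n) x) * of_bool (x (Suc n) = 1)) =
      (\<lambda>x. h (N n x) * of_bool (x (Suc n) = 1))"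
  proof
    fix x
    show "h (N (Suc n) x) * of_bool (x (Suc n) = 1) = h (N n x) * of_bool (x (Suc n) = 1)"
    proof (cases "x (Suc n) = 1")
      case True
      have "N (Suc n) x = N n x"
        by (rule H_eq_if_no_end[OF l2]) (use True le_Suc_eq in auto)
      then show ?thesis by simp
    qed simp
  qed
  also have "Ex \<dots> = p * Phi h (s - 1)"
    using Ex_next_trial[OF cylinder_H[of n h l1 k1 l2 k2], of 1]
    by (simp add: weight_def Phi_def s)
  finally show ?thesis using s by simp
qed

text \<open>For \<open>s \<ge> 2\<close>, a zero at \<open>s\<close> starts a block unless trial
  \<open>s - 1\<close> is a zero as well. In the latter case trial \<open>s\<close> completes
  nothing and contributes an independent factor \<open>q\<close>. At \<open>s = 1\<close> every zero
  starts a block and the subtracted term is 0.\<close>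

lemma Phi_start_eq: "Phi_start h s = Phi_zero h s - q * Phi_zero h (s - 1)"
proof -
  have "s = int (Suc (Suc (nat (s - 2))))" if "\<not> s \<le> 0" "s \<noteq> 1"
    using that by auto
  then consider "s \<le> 0" | "s = 1" | n where "s = int (Suc (Suc n))"
    by blast
  then show ?thesis
  proof cases
    case 1
    then show ?thesis by (simp add: Phi_start_def Phi_zero_def)
  next
    case 2
    then show ?thesis by (simp add: Phi_start_def Phi_zero_def)
  next
    case (3 n)
    have ns: "nat s = Suc (Suc n)" "nat (s - 1) = Suc n" "\<not> s \<le> 0" "\<not> s - 1 \<le> 0" using 3 by auto
    have cyl: "cylinder (Suc (Suc n)) (\<lambda>x. h (N (Suc (Suc n)) x) * of_bool (x (Suc (Suc n)) = 0))"
      by (rule cylinder_mult[OF cylinder_H cylinder_of_bool]) auto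
    have cyl': "cylinder (Suc n) (\<lambda>x. h (N (Suc n) x) * of_bool (x (Suc n) = 0))"
      by (rule cylinder_mult[OF cylinder_H cylinder_of_bool]) auto
    have eq: "(\<lambda>x. h (N (Suc (Suc n)) x) * of_bool (x (Suc (Suc n)) = 0) * of_bool (x (Suc n) = 0)) =
       (\<lambda>x. h (N (Suc n) x) * of_bool (x (Suc n) = 0) * of_bool (x (Suc (Suc n)) = 0))"
    proof
      fix x
      have "N (Suc (Suc n)) x = N (Suc n) x" if "x (Suc n) = 0"
        by (rule H_eq_if_no_end[OF l2]) (use that le_Suc_eq in auto)
      then show "h (N (Suc (Suc n)) x) * of_bool (x (Suc (Suc n)) = 0) * of_bool (x (Suc n) = 0) =
         h (N (Suc n) x) * of_bool (x (Suc n) = 0) * of_bool (x (Suc (Suc n)) = 0)"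
        by (cases "x (Suc n) = 0") simp_all
    qed
    have "Phi_zero h s = Ex (\<lambda>x. h (N (Suc (Suc n)) x) * of_bool (x (Suc (Suc n)) = 0) * of_bool (x (Suc n) = 0))
       + Ex (\<lambda>x. h (N (Suc (Suc n)) x) * of_bool (x (Suc (Suc n)) = 0) * of_bool (x (Suc n) = 1))"
      using Ex_split[OF cyl, of "Suc n"] by (simp add: Phi_zero_def ns)
    also have "Ex (\<lambda>x. h (N (Suc (Suc n)) x) * of_bool (x (Suc (Suc n)) = 0) * of_bool (x (Suc n) = 0)) =
        q * Phi_zero h (s - 1)"
      unfolding eq using Ex_next_trial[OF cyl', of 0] ns by (simp add: weight_def Phi_zero_def)
    also have "Ex (\<lambda>x. h (N (Suc (Suc n)) x) * of_bool (x (Suc (Suc n)) = 0) * of_bool (x (Suc n) = 1)) =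
        Phi_start h s"
      using ns by (simp add: Phi_start_def of_bool_conj mult.assoc)
    finally show ?thesis by simp
  qed
qed

text \<open>Taking expectations in the pathwise identity, each term factors by
  \<open>Ex_pattern\<close>, since the count at the start of the block depends only on the trials up
  to there.\<close>

lemma Phi_increment:
  assumes n: "1 \<le> n"
  shows "Phi h (int n) - Phi h (int n - 1) =
    (\<Sum>j=l1..k1. \<Sum>i=l2..k2. q ^ j * p ^ i * Phi_start (\<lambda>m. h (Suc m) - h m) (int n - int i - int j))"
proof -
  define D where "D = (\<lambda>m. h (Suc m) - h m)"
  define T where "T = (\<lambda>j i x. of_bool (i + j < n) * (D (N (n - i - j) x) * of_bool (pattern_at (n - i - j) j i x)))"
  have pattern_term: "integrable M (\<lambda>\<omega>. T j i (\<lambda>r. \<zeta> r \<omega>)) \<and>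
      Ex (T j i) = q ^ j * p ^ i * Phi_start D (int n - int i - int j)"
    if "1 \<le> j" "1 \<le> i" for j i
  proof (cases "i + j < n")
    \<comment> \<open>Such a pair would have to start at a non-positive time; both sides are 0, so
      the guard \<open>i + j < n\<close> is absorbed in the convention for
      \<open>Phi_start\<close>.\<close>
    case False
    then show ?thesis by (simp add: T_def Ex_def Phi_start_def)
  next
    case True
    define s where "s = n - i - j"
    have s: "1 \<le> s" "s + j + i = n" and ns: "int n - int i - int j = int s" using True by (auto simp: s_def)
    have T: "T j i = (\<lambda>x. D (N s x) * of_bool (pattern_at s j i x))"
      using True by (simp add: T_def s_def fun_eq_iff)
    have cp: "cylinder n (\<lambda>x. of_bool (pattern_at s j i x))"
    proof (rule cylinder_of_bool)
      fix x y :: "nat \<Rightarrow> nat" assume xy: "\<And>r. 1 \<le> r \<Longrightarrow> r \<le> n \<Longrightarrow> x r = y r"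
      have "s = 1 \<or> x (s - 1) = y (s - 1)" using s by (cases "s = 1") (auto intro!: xy)
      moreover have "\<forall>r\<in>{s..<s + j}. x r = y r"
        "\<forall>r\<in>{s + j..<s + j + i}. x r = y r" "x (s + j + i) = y (s + j + i)"
        using xy s by auto
      ultimately show "pattern_at s j i x = pattern_at s j i y" unfolding pattern_at_def by auto
    qed
    have "cylinder n (T j i)"
      unfolding T by (rule cylinder_mult[OF cylinder_mono[OF cylinder_H] cp]) (use s in auto)
    moreover have "Ex (T j i) = q ^ j * p ^ i * Phi_start D (int s)"
      unfolding T Ex_pattern[OF cylinder_H s(1) that] using s(1) by (simp add: Phi_start_def)
    ultimately show ?thesis using cylinder_integrable ns by simp
  qed
  have "Phi h (int n) - Phi h (int n - 1) = expectation (\<lambda>\<omega>. h (N n (\<lambda>r. \<zeta> r \<omega>)) - h (N (n - 1) (\<lambda>r. \<zeta> r \<omega>)))"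
    using n cylinder_integrable[OF cylinder_H] by (simp add: Phi_def Ex_def nat_diff_distrib')
  also have "\<dots> = expectation (\<lambda>\<omega>. \<Sum>(j, i)\<in>{l1..k1} \<times> {l2..k2}. T j i (\<lambda>r. \<zeta> r \<omega>))"
    unfolding H_diff_eq_sum_pattern[OF l1 l2 n] T_def D_def ..
  also have "\<dots> = (\<Sum>(j, i)\<in>{l1..k1} \<times> {l2..k2}. Ex (T j i))"
    unfolding Ex_def split_beta by (rule Bochner_Integration.integral_sum) (use pattern_term l1 l2 in auto)
  also have "\<dots> = (\<Sum>(j, i)\<in>{l1..k1} \<times> {l2..k2}. q ^ j * p ^ i * Phi_start D (int n - int i - int j))"
    by (rule sum.cong) (use pattern_term l1 l2 in auto)
  finally show ?thesis by (simp add: D_def sum.cartesian_product)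
qed

text \<open>The increment of \<open>h\<close> enters as a separate function \<open>D\<close>, so
  that each application can supply a closed form of it. The defect in the double telescoping is
  \<open>D 0\<close>.\<close>

lemma Phi_recurrence:
  fixes n l m1 m2 :: nat and a :: real
  assumes "l1 \<le> k1" "l2 \<le> k2" "0 < p" "l + 1 \<le> n"
    and "l = l1 + l2" "m1 = k1 - l1 + 1" "m2 = k2 - l2 + 1" "a = q ^ l1 * p ^ l2"
    and D: "\<And>m. h (Suc m) - h m = D m"
  shows "Phi h (int n) = Phi h (int n - 1)
     + a * (Phi D (int n - int l) - q ^ m1 * Phi D (int n - int l - int m1)
        - p ^ m2 * Phi D (int n - int l - int m2)
        + q ^ m1 * p ^ m2 * Phi D (int n - int l - int m1 - int m2))
     - a * p ^ (n - l) * D 0 *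
        (of_bool (l + 1 \<le> n \<and> n \<le> l + m2 - 1)
         - (q / p) ^ m1 * of_bool (l + m1 \<le> n \<and> n \<le> l + m1 + m2 - 1))"
proof -
  have n: "1 \<le> n" "l1 + l2 + 1 \<le> n" using assms by auto
  have "Phi h (int n) = Phi h (int n - 1) +
      (\<Sum>j=l1..k1. \<Sum>i=l2..k2. q ^ j * p ^ i * Phi_start D (int n - int i - int j))"
    using Phi_increment[OF n(1), of h] unfolding D by (simp only: diff_eq_eq add.commute)
  then show ?thesis
    unfolding double_telescope[OF Phi_zero_eq[of D] Phi_start_eq assms(1,2) n(2) assms(3,5-8)]
    by (simp only: add_diff_eq)
qed

end

section \<open>The three recurrences\<close>

theorem theorem2p7:
  fixes M :: "'a measure" and \<zeta> :: "nat \<Rightarrow> 'a \<Rightarrow> nat"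
    and l1 k1 l2 k2 l m1 m2 :: nat and p q a :: real
    and \<phi> :: "int \<Rightarrow> real \<Rightarrow> real" and P :: "int \<Rightarrow> int \<Rightarrow> real" and \<mu> :: "int \<Rightarrow> nat \<Rightarrow> real"
  assumes "1 \<le> l1" "l1 \<le> k1" "1 \<le> l2" "l2 \<le> k2"
    and "0 < p" "p \<le> 1" and "q = 1 - p"
    and "bernoulli_trials M \<zeta> p"
    and "a = q ^ l1 * p ^ l2" and "l = l1 + l2"
    and "m1 = k1 - l1 + 1" and "m2 = k2 - l2 + 1"
    and "\<phi> = H_pgf M \<zeta> l1 k1 l2 k2"
    and "P = H_pmf M \<zeta> l1 k1 l2 k2"
    and "\<mu> = H_moment M \<zeta> l1 k1 l2 k2"
  shows
    "(\<forall>n t. l + 1 \<le> n \<longrightarrow>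
        \<phi> (int n) t = \<phi> (int n - 1) t
          + a * (t - 1) * (\<phi> (int n - int l) t
              - q ^ m1 * \<phi> (int n - int l - int m1) t
              - p ^ m2 * \<phi> (int n - int l - int m2) t
              + q ^ m1 * p ^ m2 * \<phi> (int n - int l - int m1 - int m2) t)
          - a * (t - 1) * p ^ (n - l) *
              (of_bool (l + 1 \<le> n \<and> n \<le> l + m2 - 1)
               - (q / p) ^ m1 * of_bool (l + m1 \<le> n \<and> n \<le> l + m1 + m2 - 1)))
     \<and> (\<forall>n t. 0 \<le> n \<and> n \<le> int l \<longrightarrow> \<phi> n t = 1)
     \<and> (\<forall>n t. n < 0 \<longrightarrow> \<phi> n t = 0)
     \<and>
     (\<forall>n m. l + 1 \<le> n \<and> 0 \<le> m \<longrightarrow>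
        P m (int n) = P m (int n - 1)
          - a * p ^ (n - l) *
              (of_bool (m = 1 \<and> l + 1 \<le> n \<and> n \<le> l + m2 - 1)
               - of_bool (m = 0 \<and> l + 1 \<le> n \<and> n \<le> l + m2 - 1)
               - (q / p) ^ m1 *
                   (of_bool (m = 1 \<and> l + m1 \<le> n \<and> n \<le> l + m1 + m2 - 1)
                    - of_bool (m = 0 \<and> l + m1 \<le> n \<and> n \<le> l + m1 + m2 - 1)))
          + a * (P (m - 1) (int n - int l) - P m (int n - int l)
              - q ^ m1 * (P (m - 1) (int n - int l - int m1) - P m (int n - int l - int m1))
              - p ^ m2 * (P (m - 1) (int n - int l - int m2) - P m (int n - int l - int m2))
              + q ^ m1 * p ^ m2 * (P (m - 1) (int n - int l - int m1 - int m2)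
                                   - P m (int n - int l - int m1 - int m2))))
     \<and> (\<forall>n. 0 \<le> n \<and> n \<le> int l \<longrightarrow> P 0 n = 1 \<and> (\<forall>m>0. P m n = 0))
     \<and> (\<forall>n m. n < 0 \<or> m < 0 \<longrightarrow> P m n = 0)
     \<and>
     (\<forall>n j. l + 1 \<le> n \<and> 1 \<le> j \<longrightarrow>
        \<mu> (int n) j = \<mu> (int n - 1) j
          + a * (\<Sum>k = 0..j - 1. real (j choose k) *
              (\<mu> (int n - int l) k
               - q ^ m1 * \<mu> (int n - int l - int m1) k
               - p ^ m2 * \<mu> (int n - int l - int m2) k
               + q ^ m1 * p ^ m2 * \<mu> (int n - int l - int m1 - int m2) k))
          - a * p ^ (n - l) *
              (of_bool (l + 1 \<le> n \<and> n \<le> l + m2 - 1)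
               - (q / p) ^ m1 * of_bool (l + m1 \<le> n \<and> n \<le> l + m1 + m2 - 1)))
     \<and> (\<forall>n\<ge>0. \<mu> n 0 = 1)
     \<and> (\<forall>n j. 0 \<le> n \<and> n \<le> int l \<and> 1 \<le> j \<longrightarrow> \<mu> n j = 0)
     \<and> (\<forall>n j. n < 0 \<longrightarrow> \<mu> n j = 0)"
proof -
  interpret prob_space M using \<open>bernoulli_trials M \<zeta> p\<close> by (simp add: bernoulli_trials_def)
  interpret pattern_count M \<zeta> p q l1 k1 l2 k2
    using assms by unfold_locales (auto simp: bernoulli_trials_def)
  note rec = Phi_recurrence[OF assms(2,4,5) _ \<open>l = l1 + l2\<close> \<open>m1 = k1 - l1 + 1\<close> \<open>m2 = k2 - l2 + 1\<close> \<open>a = q ^ l1 * p ^ l2\<close>]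
  have phi: "\<phi> n t = Phi (\<lambda>m. t ^ m) n" for n t
    by (simp add: assms(13) H_pgf_def Phi_def Ex_def)
  have mu: "\<mu> n j = Phi (\<lambda>m. real m ^ j) n" for n j
    by (simp add: assms(15) H_moment_def Phi_def Ex_def)
  have P: "P m n = Phi (\<lambda>k. of_bool (int k = m)) n" for m n
  proof (cases "n < 0")
    case False
    have "expectation (\<lambda>\<omega>. of_bool (int (N (nat n) (\<lambda>i. \<zeta> i \<omega>)) = m) :: real) =
       expectation (indicator {\<omega> \<in> space M. int (N (nat n) (\<lambda>i. \<zeta> i \<omega>)) = m})"
      by (rule Bochner_Integration.integral_cong) (auto simp: indicator_def)
    also have "\<dots> = prob {\<omega> \<in> space M. int (N (nat n) (\<lambda>i. \<zeta> i \<omega>)) = m}"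
      by (auto intro!: arg_cong[of _ _ prob])
    finally show ?thesis using False by (simp add: assms(14) H_pmf_def Phi_def Ex_def)
  qed (simp add: assms(14) H_pmf_def Phi_def)
  have pgf: "\<phi> (int n) t = \<phi> (int n - 1) t
          + a * (t - 1) * (\<phi> (int n - int l) t
              - q ^ m1 * \<phi> (int n - int l - int m1) t
              - p ^ m2 * \<phi> (int n - int l - int m2) t
              + q ^ m1 * p ^ m2 * \<phi> (int n - int l - int m1 - int m2) t)
          - a * (t - 1) * p ^ (n - l) *
              (of_bool (l + 1 \<le> n \<and> n \<le> l + m2 - 1)
               - (q / p) ^ m1 * of_bool (l + m1 \<le> n \<and> n \<le> l + m1 + m2 - 1))"
    if "l + 1 \<le> n" for n t
    \<comment> \<open>The increment of \<open>t ^ m\<close> is \<open>(t - 1) * t ^ m\<close>, with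
      value \<open>t - 1\<close> at 0.\<close>
    unfolding phi
    by (subst rec[OF that, of _ "\<lambda>m. (t - 1) * t ^ m"])
      (simp_all only: Phi_cmult power_0, simp_all add: algebra_simps)
  have pmf: "P m (int n) = P m (int n - 1)
          - a * p ^ (n - l) *
              (of_bool (m = 1 \<and> l + 1 \<le> n \<and> n \<le> l + m2 - 1)
               - of_bool (m = 0 \<and> l + 1 \<le> n \<and> n \<le> l + m2 - 1)
               - (q / p) ^ m1 *
                   (of_bool (m = 1 \<and> l + m1 \<le> n \<and> n \<le> l + m1 + m2 - 1)
                    - of_bool (m = 0 \<and> l + m1 \<le> n \<and> n \<le> l + m1 + m2 - 1)))
          + a * (P (m - 1) (int n - int l) - P m (int n - int l)
              - q ^ m1 * (P (m - 1) (int n - int l - int m1) - P m (int n - int l - int m1))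
              - p ^ m2 * (P (m - 1) (int n - int l - int m2) - P m (int n - int l - int m2))
              + q ^ m1 * p ^ m2 * (P (m - 1) (int n - int l - int m1 - int m2)
                                   - P m (int n - int l - int m1 - int m2)))"
    if "l + 1 \<le> n" for n m
  proof -
    \<comment> \<open>The equation \<open>k + 1 = m\<close> is rewritten as \<open>k = m - 1\<close>
      over the integers, where it is also correct for \<open>m = 0\<close>; this produces the terms
      with index \<open>m - 1\<close>.\<close>
    have D: "of_bool (int (Suc k) = m) - of_bool (int k = m) =
        (of_bool (int k = m - 1) - of_bool (int k = m) :: real)" for k
      by auto
    have D0: "of_bool (int 0 = m - 1) - of_bool (int 0 = m) = (of_bool (m = 1) - of_bool (m = 0) :: real)"
      by auto
    show ?thesis
      using rec[where n = n and h = "\<lambda>k. of_bool (int k = m)"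
          and D = "\<lambda>k. of_bool (int k = m - 1) - of_bool (int k = m)", OF that D]
      unfolding P Phi_diff D0 of_bool_conj by (simp add: algebra_simps)
  qed
  have moment: "\<mu> (int n) j = \<mu> (int n - 1) j
          + a * (\<Sum>k = 0..j - 1. real (j choose k) *
              (\<mu> (int n - int l) k
               - q ^ m1 * \<mu> (int n - int l - int m1) k
               - p ^ m2 * \<mu> (int n - int l - int m2) k
               + q ^ m1 * p ^ m2 * \<mu> (int n - int l - int m1 - int m2) k))
          - a * p ^ (n - l) *
              (of_bool (l + 1 \<le> n \<and> n \<le> l + m2 - 1)
               - (q / p) ^ m1 * of_bool (l + m1 \<le> n \<and> n \<le> l + m1 + m2 - 1))"
    if "l + 1 \<le> n" "1 \<le> j" for n j
  proof -
    let ?D = "\<lambda>m. \<Sum>k=0..j - 1. real (j choose k) * real m ^ k"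
    \<comment> \<open>The binomial theorem without its top term \<open>k = j\<close>, which cancels
      against \<open>real m ^ j\<close>.\<close>
    have D: "real (Suc m) ^ j - real m ^ j = ?D m" for m
    proof -
      have "real (Suc m) ^ j = (\<Sum>k\<le>j. real (j choose k) * real m ^ k)"
        using binomial_ring[of "real m" 1 j] by (simp add: add.commute)
      also have "{..j} = insert j {0..j - 1}" using that(2) by auto
      finally show ?thesis using that(2) by simp
    qed
    \<comment> \<open>The increment at 0 is \<open>1 ^ j - 0 ^ j\<close>, which equals 1 because
      \<open>j \<ge> 1\<close>.\<close>
    have D0: "?D 0 = 1" using D[of 0] that(2) by simp
    show ?thesis
      using rec[where n = n and h = "\<lambda>m. real m ^ j" and D = ?D, OF that(1) D]
      unfolding mu Phi_sum[OF finite_atLeastAtMost] Phi_cmult D0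
      by (simp add: sum_distrib_left sum.distrib sum_subtractf algebra_simps)
  qed
  have initial: "\<phi> n t = 1" "P 0 n = 1" "0 < m \<Longrightarrow> P m n = 0" "1 \<le> j \<Longrightarrow> \<mu> n j = 0"
    if "0 \<le> n" "n \<le> int l" for n t m j
    unfolding phi P mu using Phi_initial[of n] that assms(10) by auto
  have "\<mu> n 0 = 1" if "0 \<le> n" for n
    using that by (simp add: mu Phi_def Ex_def prob_space)
  moreover have "P m n = 0" if "n < 0 \<or> m < 0" for n m
  proof (cases "n < 0")
    case False
    \<comment> \<open>Here \<open>m < 0\<close>, and a count is never negative.\<close>
    with that have "(\<lambda>k. of_bool (int k = m) :: real) = (\<lambda>k. 0)" by auto
    then show ?thesis by (simp add: P Phi_def Ex_def)
  qed (simp add: P Phi_def)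
  moreover have "\<phi> n t = 0" "\<mu> n j = 0" if "n < 0" for n t j
    using that by (simp_all add: phi mu Phi_def)
  ultimately show ?thesis
    using pgf pmf moment initial by (intro conjI allI impI; (elim conjE)?; (assumption | blast)?)
qed

end
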